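(* Let $E=(E^0,E^1,r,s)$ be a directed graph. Let $\mathrm{PIso}(E^* )$ be the set of all partial isomorphisms of the forest $T_E$, with domain and codomain maps $d,c:\mathrm{PIso}(E^* )\to E^0$. Then $(\mathrm{PIso}(E^* ),E^0,c,d)$ is a groupoid in which the product is given by composition of functions, the identity morphism at $v\in E^0$ is $\mathrm{id}_v:vE^*\to vE^*$, $\mathrm{id}_v(\mu)=\mu$, and the inverse of $g\in\mathrm{PIso}(E^* )$ is the inverse of the function $g:d(g)E^*\to c(g)E^*$.
   Context: For a directed graph $E=(E^0,E^1,r,s)$, $E^k$ is the set of paths $\mu=\mu_1\cdots\mu_k$ with $\mu_i\in E^1$ and $s(\mu_i)=r(\mu_{i+1})$; $r(\mu)=r(\mu_1)$, $s(\mu)=s(\mu_k)$; vertices are paths of length $0$ with $r(v)=s(v)=v$; $E^*=\bigsqcup_{k\ge0}E^k$; $vE^k=\{\mu\in E^k:r(\mu)=v\}$ and $vE^*=\bigsqcup_{k\ge0}vE^k$. The forest $T_E$ is the undirected graph with vertex set $E^*$ and edges $\{\mu,\mu e\}$ for $\mu\in E^*$, $e\in E^1$, $s(\mu)=r(e)$; it is the disjoint union of the rooted trees $vE^*$, $v\in E^0$. A partial isomorphism of $T_E$ consists of two vertices $v,w\in E^0$ and a bijection $g:vE^*\to wE^*$ such that $g|_{vE^k}$ is a bijection onto $wE^k$ for every $k\in\mathbb{N}$ ($0\in\mathbb{N}$), and $g(\mu e)\in g(\mu)E^1$ for all $\mu e\in vE^*$ with $e\in E^1$. Put $d(g):=v$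 and $c(g):=w$. A groupoid is a small category with inverses: a set $G^0$ of objects, a set $G$ of morphisms, functions $c,d:G\to G^0$, and a partially defined product $(g,h)\mapsto gh$ on $\{(g,h):d(g)=c(h)\}$, such that $(G,G^0,c,d)$ is a category and every $g\in G$ has an inverse. *)

theory Defs
  imports "Graph_Theory.Digraph" "HOL-Library.FuncSet"
begin

text \<open>
  A directed graph \<open>(E\<^sup>0, E\<^sup>1, r, s)\<close> is a \<^locale>\<open>wf_digraph\<close> with \<open>E\<^sup>0 = verts E\<close>,
  \<open>E\<^sup>1 = arcs E\<close>, \<open>r = head E\<close> and \<open>s = tail E\<close>.

  A path \<open>\<mu>\<close> is encoded as its range \<open>r(\<mu>)\<close> together with its list of edges. The vertex
  component is forced by the edges unless the list is empty, and the path \<open>(v, [])\<close> of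
  length \<open>0\<close> is the vertex \<open>v\<close>. Edges compose as \<open>s(\<mu>\<^sub>i) = r(\<mu>\<^sub>i\<^sub>+\<^sub>1)\<close>, so edge lists run against
  the direction of the arcs (unlike the walks of the library).
\<close>

type_synonym ('v, 'e) path = "'v \<times> 'e list"

definition paths_of_length :: "('v, 'e) pre_digraph \<Rightarrow> nat \<Rightarrow> ('v, 'e) path set" where
  "paths_of_length E k = {(v, es). v \<in> verts E \<and> set es \<subseteq> arcs E \<and> length es = k \<and>
     (es \<noteq> [] \<longrightarrow> v = head E (hd es)) \<and>
     (\<forall>i. Suc i < k \<longrightarrow> tail E (es ! i) = head E (es ! Suc i))}"

definition path_range :: "('v, 'e) path \<Rightarrow> 'v" where
  "path_range \<mu> = fst \<mu>"

definition path_source :: "('v, 'e) pre_digraph \<Rightarrow> ('v, 'e) path \<Rightarrow> 'v" where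
  "path_source E \<mu> = (if snd \<mu> = [] then fst \<mu> else tail E (last (snd \<mu>)))"

definition paths :: "('v, 'e) pre_digraph \<Rightarrow> ('v, 'e) path set" where
  "paths E = (\<Union>k. paths_of_length E k)"

definition paths_at_of_length :: "('v, 'e) pre_digraph \<Rightarrow> 'v \<Rightarrow> nat \<Rightarrow> ('v, 'e) path set" where
  "paths_at_of_length E v k = {\<mu> \<in> paths_of_length E k. path_range \<mu> = v}"

definition paths_at :: "('v, 'e) pre_digraph \<Rightarrow> 'v \<Rightarrow> ('v, 'e) path set" where
  "paths_at E v = (\<Union>k. paths_at_of_length E v k)"

text \<open>The path \<open>\<mu>e\<close>, meaningful when \<open>s(\<mu>) = r(e)\<close>, and the set \<open>\<mu>E\<^sup>1\<close>.\<close>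

definition path_snoc :: "('v, 'e) path \<Rightarrow> 'e \<Rightarrow> ('v, 'e) path" where
  "path_snoc \<mu> e = (fst \<mu>, snd \<mu> @ [e])"

definition path_extensions :: "('v, 'e) pre_digraph \<Rightarrow> ('v, 'e) path \<Rightarrow> ('v, 'e) path set" where
  "path_extensions E \<mu> = {path_snoc \<mu> e | e. e \<in> arcs E \<and> path_source E \<mu> = head E e}"

text \<open>
  A partial isomorphism carries its two vertices along with the function. The function is
  required to be \<^const>\<open>extensional\<close>, so that equality in the type is equality of functions
  \<open>vE\<^sup>* \<rightarrow> wE\<^sup>*\<close>.
\<close>

datatype ('v, 'e) piso =
  Piso (piso_dom: 'v) (piso_cod: 'v) (piso_map: "('v, 'e) path \<Rightarrow> ('v, 'e) path")

definition is_partial_iso ::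
    "('v, 'e) pre_digraph \<Rightarrow> 'v \<Rightarrow> 'v \<Rightarrow> (('v, 'e) path \<Rightarrow> ('v, 'e) path) \<Rightarrow> bool" where
  "is_partial_iso E v w g \<longleftrightarrow>
     v \<in> verts E \<and> w \<in> verts E \<and>
     bij_betw g (paths_at E v) (paths_at E w) \<and>
     (\<forall>k. bij_betw g (paths_at_of_length E v k) (paths_at_of_length E w k)) \<and>
     (\<forall>\<mu> \<in> paths E. \<forall>e \<in> arcs E. path_source E \<mu> = head E e \<and> path_snoc \<mu> e \<in> paths_at E v \<longrightarrow>
        g (path_snoc \<mu> e) \<in> path_extensions E (g \<mu>))"

definition PIso :: "('v, 'e) pre_digraph \<Rightarrow> ('v, 'e) piso set" where
  "PIso E = {g. is_partial_iso E (piso_dom g) (piso_cod g) (piso_map g) \<and>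
                piso_map g \<in> extensional (paths_at E (piso_dom g))}"

definition piso_comp ::
    "('v, 'e) pre_digraph \<Rightarrow> ('v, 'e) piso \<Rightarrow> ('v, 'e) piso \<Rightarrow> ('v, 'e) piso" where
  "piso_comp E g h = Piso (piso_dom h) (piso_cod g)
     (compose (paths_at E (piso_dom h)) (piso_map g) (piso_map h))"

definition piso_id :: "('v, 'e) pre_digraph \<Rightarrow> 'v \<Rightarrow> ('v, 'e) piso" where
  "piso_id E v = Piso v v (\<lambda>\<mu> \<in> paths_at E v. \<mu>)"

definition piso_inv :: "('v, 'e) pre_digraph \<Rightarrow> ('v, 'e) piso \<Rightarrow> ('v, 'e) piso" where
  "piso_inv E g = Piso (piso_cod g) (piso_dom g)
     (\<lambda>\<mu> \<in> paths_at E (piso_cod g). inv_into (paths_at E (piso_dom g)) (piso_map g) \<mu>)"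

text \<open>
  Small categories and groupoids with morphism set \<open>M\<close>, object set \<open>X\<close>, codomain map \<open>c\<close> and
  domain map \<open>d\<close>. The partially defined product is a total function of which only the values
  at \<open>(g, h) \<in> M \<times> M\<close> with \<open>d g = c h\<close> matter.
\<close>

definition is_identity_at ::
    "'m set \<Rightarrow> ('m \<Rightarrow> 'x) \<Rightarrow> ('m \<Rightarrow> 'x) \<Rightarrow> ('m \<Rightarrow> 'm \<Rightarrow> 'm) \<Rightarrow> 'x \<Rightarrow> 'm \<Rightarrow> bool" where
  "is_identity_at M c d mult v i \<longleftrightarrow> i \<in> M \<and> c i = v \<and> d i = v \<and>
     (\<forall>g \<in> M. d g = v \<longrightarrow> mult g i = g) \<and> (\<forall>g \<in> M. c g = v \<longrightarrow> mult i g = g)"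

definition is_inverse_of ::
    "'m set \<Rightarrow> ('m \<Rightarrow> 'x) \<Rightarrow> ('m \<Rightarrow> 'x) \<Rightarrow> ('m \<Rightarrow> 'm \<Rightarrow> 'm) \<Rightarrow> 'm \<Rightarrow> 'm \<Rightarrow> bool" where
  "is_inverse_of M c d mult g h \<longleftrightarrow> h \<in> M \<and> d h = c g \<and> c h = d g \<and>
     is_identity_at M c d mult (c g) (mult g h) \<and> is_identity_at M c d mult (d g) (mult h g)"

locale small_category =
  fixes M :: "'m set" and X :: "'x set" and c d :: "'m \<Rightarrow> 'x" and mult :: "'m \<Rightarrow> 'm \<Rightarrow> 'm"
  assumes cod_in: "g \<in> M \<Longrightarrow> c g \<in> X"
    and dom_in: "g \<in> M \<Longrightarrow> d g \<in> X"
    and mult_closed: "\<lbrakk>g \<in> M; h \<in> M; d g = c h\<rbrakk> \<Longrightarrow> mult g h \<in> M"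
    and cod_mult: "\<lbrakk>g \<in> M; h \<in> M; d g = c h\<rbrakk> \<Longrightarrow> c (mult g h) = c g"
    and dom_mult: "\<lbrakk>g \<in> M; h \<in> M; d g = c h\<rbrakk> \<Longrightarrow> d (mult g h) = d h"
    and mult_assoc: "\<lbrakk>f \<in> M; g \<in> M; h \<in> M; d f = c g; d g = c h\<rbrakk> \<Longrightarrow>
      mult (mult f g) h = mult f (mult g h)"
    and ex_identity: "v \<in> X \<Longrightarrow> \<exists>i. is_identity_at M c d mult v i"

locale groupoid = small_category +
  assumes ex_inverse: "g \<in> M \<Longrightarrow> \<exists>h. is_inverse_of M c d mult g h"

end

theory Submission
  imports Defs
begin

text \<open>
  The level conditions pass to composites and inverses because bijections compose and invert.
  For the edge condition of an inverse: if \<open>g(\<nu>) = \<mu>e\<close> with \<open>\<nu> = \<nu>'f\<close>, then \<open>g(\<nu>)\<close> also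
  extends \<open>g(\<nu>')\<close> by one edge, and the last edge of a path splits off uniquely, so
  \<open>g(\<nu>') = \<mu>\<close>; hence \<open>g\<inverse>(\<mu>e) = \<nu>'f\<close> extends \<open>g\<inverse>(\<mu>) = \<nu>'\<close>.
\<close>

section \<open>Splitting off the last edge of a path\<close>

lemma path_snoc_eq_iff [simp]: "path_snoc \<mu> e = path_snoc \<nu> f \<longleftrightarrow> \<mu> = \<nu> \<and> e = f"
  by (auto simp: path_snoc_def prod_eq_iff)

text \<open>Appending an edge adds a single matching condition, at the junction. Over a length-0
  path it comes from the range clause for \<open>hd\<close>; otherwise it is the last instance of
  the chain condition. Once this is settled, no later argument handles edge indices.\<close>

lemma path_snoc_in_paths_of_length_iff:
  "path_snoc \<mu> e \<in> paths_of_length E (Suc k) \<longleftrightarrow>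
     \<mu> \<in> paths_of_length E k \<and> e \<in> arcs E \<and> path_source E \<mu> = head E e"
proof (cases \<mu>)
  case (Pair v es)
  show ?thesis
  proof (cases "es = []")
    case True
    then show ?thesis
      by (auto simp: Pair path_snoc_def paths_of_length_def path_source_def)
  next
    case False
    have chain: "(\<forall>i. Suc i < Suc k \<longrightarrow> tail E ((es @ [e]) ! i) = head E ((es @ [e]) ! Suc i)) \<longleftrightarrow>
      (\<forall>i. Suc i < k \<longrightarrow> tail E (es ! i) = head E (es ! Suc i)) \<and> tail E (last es) = head E e"
      (is "?L \<longleftrightarrow> ?R") if k: "length es = k"
    proof
      assume L: ?L
      have "tail E (es ! i) = head E (es ! Suc i)" if "Suc i < k" for i
        using L[rule_format, of i] that k by (simp add: nth_append)
      moreover have "tail E (last es) = head E e"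
        \<comment> \<open>Position \<open>k - 1\<close> of \<open>es @ [e]\<close> holds
          \<open>last es\<close> and the next one holds \<open>e\<close>; the case
          \<open>k = 0\<close> is excluded by \<open>es \<noteq> []\<close>.\<close>
        using L[rule_format, of "k - 1"] k False by (cases k) (simp_all add: nth_append last_conv_nth)
      ultimately show ?R by blast
    next
      assume R: ?R
      show ?L
      proof (intro allI impI)
        fix i assume "Suc i < Suc k"
        then consider "Suc i < k" | "Suc i = k" by linarith
        then show "tail E ((es @ [e]) ! i) = head E ((es @ [e]) ! Suc i)"
        proof cases
          case 1
          then show ?thesis using R k by (simp add: nth_append)
        next
          case 2
          then have "last es = es ! i" using False k by (simp add: last_conv_nth flip: 2)
          then show ?thesis using R k 2 by (simp add: nth_append)
        qed
      qed
    qed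
    have "path_snoc \<mu> e \<in> paths_of_length E (Suc k) \<longleftrightarrow>
      v \<in> verts E \<and> set es \<subseteq> arcs E \<and> e \<in> arcs E \<and> v = head E (hd es) \<and> length es = k \<and>
      (\<forall>i. Suc i < Suc k \<longrightarrow> tail E ((es @ [e]) ! i) = head E ((es @ [e]) ! Suc i))"
      using False by (simp add: Pair path_snoc_def paths_of_length_def conj_ac)
    also have "\<dots> \<longleftrightarrow>
      v \<in> verts E \<and> set es \<subseteq> arcs E \<and> e \<in> arcs E \<and> v = head E (hd es) \<and> length es = k \<and>
      (\<forall>i. Suc i < k \<longrightarrow> tail E (es ! i) = head E (es ! Suc i)) \<and> tail E (last es) = head E e"
      \<comment> \<open>\<open>conj_cong\<close> makes the conjunct \<open>length es = k\<close>
        available as the hypothesis of \<open>chain\<close>.\<close>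
      using chain by (simp only: cong: conj_cong)
    also have "\<dots> \<longleftrightarrow>
      \<mu> \<in> paths_of_length E k \<and> e \<in> arcs E \<and> path_source E \<mu> = head E e"
      using False by (simp add: Pair paths_of_length_def path_source_def conj_ac)
    finally show ?thesis .
  qed
qed

lemma path_snoc_in_paths_at_of_length_iff:
  "path_snoc \<mu> e \<in> paths_at_of_length E v (Suc k) \<longleftrightarrow>
     \<mu> \<in> paths_at_of_length E v k \<and> e \<in> arcs E \<and> path_source E \<mu> = head E e"
  by (auto simp: paths_at_of_length_def path_snoc_in_paths_of_length_iff)
    (auto simp: path_range_def path_snoc_def)

lemma path_snoc_notin_paths_at_of_length_0: "path_snoc \<mu> e \<notin> paths_at_of_length E v 0"
  by (simp add: paths_at_of_length_def paths_of_length_def path_snoc_def)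

text \<open>An extended path has positive length, so the union over all lengths can be indexed by
  successors.\<close>

lemma path_snoc_in_paths_at_iff_ex:
  "path_snoc \<mu> e \<in> paths_at E v \<longleftrightarrow> (\<exists>k. path_snoc \<mu> e \<in> paths_at_of_length E v (Suc k))"
  unfolding paths_at_def using path_snoc_notin_paths_at_of_length_0 not0_implies_Suc
  by (metis UN_E UN_I UNIV_I)

lemma path_snoc_in_paths_at_iff:
  "path_snoc \<mu> e \<in> paths_at E v \<longleftrightarrow>
     \<mu> \<in> paths_at E v \<and> e \<in> arcs E \<and> path_source E \<mu> = head E e"
  unfolding path_snoc_in_paths_at_iff_ex
  by (auto simp: path_snoc_in_paths_at_of_length_iff paths_at_def)

text \<open>Provides the decomposition \<open>\<nu> = \<nu>'f\<close> on which the argument for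
  inverses rests.\<close>

lemma paths_at_of_length_SucE:
  assumes "\<nu> \<in> paths_at_of_length E v (Suc k)"
  obtains \<mu> e where "\<nu> = path_snoc \<mu> e" "\<mu> \<in> paths_at_of_length E v k"
    "e \<in> arcs E" "path_source E \<mu> = head E e"
proof -
  have "snd \<nu> \<noteq> []"
    using assms by (auto simp: paths_at_of_length_def paths_of_length_def)
  then have \<nu>: "\<nu> = path_snoc (fst \<nu>, butlast (snd \<nu>)) (last (snd \<nu>))"
    by (simp add: path_snoc_def)
  with assms have "path_snoc (fst \<nu>, butlast (snd \<nu>)) (last (snd \<nu>)) \<in> paths_at_of_length E v (Suc k)"
    by simp
  then show thesis
    unfolding path_snoc_in_paths_at_of_length_iff by (intro that[OF \<nu>]) auto
qed

lemma paths_at_of_length_subset: "paths_at_of_length E v k \<subseteq> paths_at E v"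
  by (auto simp: paths_at_def)

lemma paths_at_subset: "paths_at E v \<subseteq> paths E"
  by (auto simp: paths_at_def paths_at_of_length_def paths_def)

section \<open>Partial isomorphisms: identities, composites and inverses\<close>

text \<open>A path at \<open>v\<close> ending in \<open>e\<close> has a prefix that is again a path
  at \<open>v\<close> and composes with \<open>e\<close>, so the edge condition can be quantified
  over membership of \<open>path_snoc \<mu> e\<close> alone.\<close>

lemma is_partial_iso_iff:
  "is_partial_iso E v w g \<longleftrightarrow> v \<in> verts E \<and> w \<in> verts E \<and>
     bij_betw g (paths_at E v) (paths_at E w) \<and>
     (\<forall>k. bij_betw g (paths_at_of_length E v k) (paths_at_of_length E w k)) \<and>
     (\<forall>\<mu> e. path_snoc \<mu> e \<in> paths_at E v \<longrightarrow> g (path_snoc \<mu> e) \<in> path_extensions E (g \<mu>))"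
proof -
  have "(\<forall>\<mu> \<in> paths E. \<forall>e \<in> arcs E.
      path_source E \<mu> = head E e \<and> path_snoc \<mu> e \<in> paths_at E v \<longrightarrow> P \<mu> e) \<longleftrightarrow>
    (\<forall>\<mu> e. path_snoc \<mu> e \<in> paths_at E v \<longrightarrow> P \<mu> e)" for P
    by (auto simp: path_snoc_in_paths_at_iff simp del: split_paired_All
        dest: subsetD[OF paths_at_subset])
  then show ?thesis
    unfolding is_partial_iso_def by (simp only:)
qed

lemma is_partial_iso_bij_betw:
  "is_partial_iso E v w g \<Longrightarrow> bij_betw g (paths_at E v) (paths_at E w)"
  by (simp add: is_partial_iso_def)

lemma is_partial_iso_path_snoc:
  assumes "is_partial_iso E v w g" "path_snoc \<mu> e \<in> paths_at E v"
  obtains f where "g (path_snoc \<mu> e) = path_snoc (g \<mu>) f" "f \<in> arcs E"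
    "path_source E (g \<mu>) = head E f"
proof -
  have "g (path_snoc \<mu> e) \<in> path_extensions E (g \<mu>)"
    using assms by (simp add: is_partial_iso_iff del: split_paired_All)
  then show thesis
    by (auto simp: path_extensions_def intro: that)
qed

text \<open>The edge condition evaluates the function at \<open>\<mu>\<close> as well as at
  \<open>path_snoc \<mu> e\<close>; both lie in \<open>paths_at E v\<close> because prefixes keep
  their range. This permits passing between a function and its restriction.\<close>

lemma is_partial_iso_cong:
  assumes "\<And>\<mu>. \<mu> \<in> paths_at E v \<Longrightarrow> g \<mu> = h \<mu>"
  shows "is_partial_iso E v w g \<longleftrightarrow> is_partial_iso E v w h"
proof -
  have "bij_betw g (paths_at E v) B \<longleftrightarrow> bij_betw h (paths_at E v) B" for B
    using assms by (rule bij_betw_cong)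
  moreover have "bij_betw g (paths_at_of_length E v k) B \<longleftrightarrow> bij_betw h (paths_at_of_length E v k) B"
    for k B
    by (rule bij_betw_cong) (rule assms[OF subsetD[OF paths_at_of_length_subset]])
  moreover have "g (path_snoc \<mu> e) \<in> path_extensions E (g \<mu>) \<longleftrightarrow>
      h (path_snoc \<mu> e) \<in> path_extensions E (h \<mu>)" if "path_snoc \<mu> e \<in> paths_at E v" for \<mu> e
    using assms that by (simp add: path_snoc_in_paths_at_iff)
  ultimately show ?thesis
    unfolding is_partial_iso_iff by auto
qed

lemma is_partial_iso_id: "v \<in> verts E \<Longrightarrow> is_partial_iso E v v (\<lambda>\<mu>. \<mu>)"
  by (auto simp: is_partial_iso_def path_extensions_def bij_betw_def)

text \<open>\<open>h\<close> turns the last edge \<open>e\<close> into some \<open>f\<close>, and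
  \<open>g\<close> turns \<open>f\<close> into some \<open>f'\<close>. The edge condition of
  \<open>g\<close> applies because \<open>h\<close> maps into \<open>paths_at E v\<close>.\<close>

lemma is_partial_iso_comp:
  assumes h: "is_partial_iso E u v h" and g: "is_partial_iso E v w g"
  shows "is_partial_iso E u w (g \<circ> h)"
  unfolding is_partial_iso_iff
proof (intro conjI allI impI)
  fix \<mu> e assume \<mu>e: "path_snoc \<mu> e \<in> paths_at E u"
  with h obtain f where f: "h (path_snoc \<mu> e) = path_snoc (h \<mu>) f"
    by (rule is_partial_iso_path_snoc)
  have "h (path_snoc \<mu> e) \<in> paths_at E v"
    using is_partial_iso_bij_betw[OF h] \<mu>e by (rule bij_betw_apply)
  then have "path_snoc (h \<mu>) f \<in> paths_at E v" by (simp add: f)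
  with g obtain f' where "g (path_snoc (h \<mu>) f) = path_snoc (g (h \<mu>)) f'" "f' \<in> arcs E"
    "path_source E (g (h \<mu>)) = head E f'"
    by (rule is_partial_iso_path_snoc)
  then show "(g \<circ> h) (path_snoc \<mu> e) \<in> path_extensions E ((g \<circ> h) \<mu>)"
    by (auto simp: f path_extensions_def)
next
  fix k
  show "bij_betw (g \<circ> h) (paths_at_of_length E u k) (paths_at_of_length E w k)"
    using h g unfolding is_partial_iso_def by (blast intro: bij_betw_trans)
qed (use h g in \<open>auto simp: is_partial_iso_def intro: bij_betw_trans\<close>)

lemma is_partial_iso_inv:
  assumes g: "is_partial_iso E v w g"
  shows "is_partial_iso E w v (inv_into (paths_at E v) g)"
    (is "is_partial_iso E w v ?h")
proof -
  have bij: "bij_betw g (paths_at E v) (paths_at E w)"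
    using g by (rule is_partial_iso_bij_betw)
  \<comment> \<open>\<open>?h\<close> inverts \<open>g\<close> on the whole tree at once. Since
    \<open>g\<close> maps each level onto the level of the same length, \<open>?h\<close> restricts
    to a bijection between these levels.\<close>
  have lev: "bij_betw ?h (paths_at_of_length E w k) (paths_at_of_length E v k)" for k
    using bij paths_at_of_length_subset
    by (rule bij_betw_inv_into_subset) (use g in \<open>simp add: is_partial_iso_def bij_betw_def\<close>)
  show ?thesis
    unfolding is_partial_iso_iff
  proof (intro conjI allI impI)
    fix \<mu> e assume \<mu>e: "path_snoc \<mu> e \<in> paths_at E w"
    \<comment> \<open>The preimage has the same length \<open>Suc k\<close>, hence a last edge
      \<open>f\<close> to split off.\<close>
    then obtain k where "path_snoc \<mu> e \<in> paths_at_of_length E w (Suc k)"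
      unfolding path_snoc_in_paths_at_iff_ex by blast
    then have "?h (path_snoc \<mu> e) \<in> paths_at_of_length E v (Suc k)"
      using lev by (rule bij_betw_apply[rotated])
    then obtain \<nu> f where \<nu>f: "?h (path_snoc \<mu> e) = path_snoc \<nu> f"
      "\<nu> \<in> paths_at_of_length E v k" "f \<in> arcs E" "path_source E \<nu> = head E f"
      by (rule paths_at_of_length_SucE)
    then have \<nu>: "\<nu> \<in> paths_at E v" by (auto simp: paths_at_def)
    then have "path_snoc \<nu> f \<in> paths_at E v"
      using \<nu>f by (simp add: path_snoc_in_paths_at_iff)
    with g obtain e' where "g (path_snoc \<nu> f) = path_snoc (g \<nu>) e'"
      by (rule is_partial_iso_path_snoc)
    moreover have "g (path_snoc \<nu> f) = path_snoc \<mu> e"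
      using bij_betw_inv_into_right[OF bij \<mu>e] \<nu>f by simp
    ultimately have "g \<nu> = \<mu>" by simp
    then have "?h \<mu> = \<nu>" using bij_betw_inv_into_left[OF bij \<nu>] by simp
    then show "?h (path_snoc \<mu> e) \<in> path_extensions E (?h \<mu>)"
      using \<nu>f by (auto simp: path_extensions_def)
  qed (use g lev bij_betw_inv_into[OF bij] in \<open>auto simp: is_partial_iso_def\<close>)
qed

section \<open>Groupoid laws for the extensional encoding\<close>

lemma PIso_bij_betw:
  "g \<in> PIso E \<Longrightarrow> bij_betw (piso_map g) (paths_at E (piso_dom g)) (paths_at E (piso_cod g))"
  by (simp add: PIso_def is_partial_iso_bij_betw)

text \<open>Products, identities and inverses are all built from restricted functions. Restriction
  gives extensionality, so closure reduces to the results on unrestricted functions.\<close>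

lemma Piso_restrict_in_PIso_iff:
  "Piso v w (restrict g (paths_at E v)) \<in> PIso E \<longleftrightarrow> is_partial_iso E v w g"
proof -
  have "is_partial_iso E v w (restrict g (paths_at E v)) \<longleftrightarrow> is_partial_iso E v w g"
    by (rule is_partial_iso_cong) simp
  then show ?thesis by (simp add: PIso_def)
qed

lemma piso_id_in_PIso: "v \<in> verts E \<Longrightarrow> piso_id E v \<in> PIso E"
  by (simp add: piso_id_def Piso_restrict_in_PIso_iff is_partial_iso_id)

lemma piso_comp_in_PIso:
  assumes "g \<in> PIso E" "h \<in> PIso E" "piso_dom g = piso_cod h"
  shows "piso_comp E g h \<in> PIso E"
proof -
  have "is_partial_iso E (piso_dom h) (piso_cod g) (piso_map g \<circ> piso_map h)"
    using assms by (auto simp: PIso_def intro: is_partial_iso_comp)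
  then show ?thesis
    by (simp add: piso_comp_def compose_def o_def Piso_restrict_in_PIso_iff)
qed

lemma piso_inv_in_PIso: "g \<in> PIso E \<Longrightarrow> piso_inv E g \<in> PIso E"
  unfolding piso_inv_def Piso_restrict_in_PIso_iff
  by (rule is_partial_iso_inv) (simp add: PIso_def)

text \<open>On the left, the inner \<open>compose\<close> is evaluated at values of
  \<open>h\<close>. These lie in the domain of \<open>g\<close>, so the default value
  \<open>undefined\<close> never enters there.\<close>

lemma piso_comp_assoc:
  assumes "h \<in> PIso E" "piso_dom g = piso_cod h"
  shows "piso_comp E (piso_comp E f g) h = piso_comp E f (piso_comp E g h)"
  using bij_betw_apply[OF PIso_bij_betw[OF assms(1)]] assms(2)
  by (auto simp: piso_comp_def compose_def)

text \<open>On the domain both maps agree; off it both are \<open>undefined\<close>, by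
  extensionality of \<open>piso_map g\<close>.\<close>

lemma piso_comp_id:
  assumes "g \<in> PIso E"
  shows "piso_comp E g (piso_id E (piso_dom g)) = g"
  using assms by (cases g) (auto simp: PIso_def piso_comp_def piso_id_def compose_def
    extensional_def)

lemma piso_id_comp:
  assumes "g \<in> PIso E"
  shows "piso_comp E (piso_id E (piso_cod g)) g = g"
  \<comment> \<open>The restricted identity fixes the values of \<open>g\<close> because they lie in
    \<open>paths_at E (piso_cod g)\<close>.\<close>
  using assms bij_betw_apply[OF PIso_bij_betw[OF assms]]
  by (cases g) (auto simp: PIso_def piso_comp_def piso_id_def compose_def extensional_def)

lemma piso_comp_inv:
  assumes "g \<in> PIso E"
  shows "piso_comp E g (piso_inv E g) = piso_id E (piso_cod g)"
  using bij_betw_inv_into_right[OF PIso_bij_betw[OF assms]]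
  by (auto simp: piso_comp_def piso_id_def piso_inv_def compose_def)

lemma piso_inv_comp:
  assumes "g \<in> PIso E"
  shows "piso_comp E (piso_inv E g) g = piso_id E (piso_dom g)"
  \<comment> \<open>The second fact places the values of \<open>g\<close> where the restricted
    inverse agrees with \<open>inv_into\<close>.\<close>
  using bij_betw_inv_into_left[OF PIso_bij_betw[OF assms]]
    bij_betw_apply[OF PIso_bij_betw[OF assms]]
  by (auto simp: piso_comp_def piso_id_def piso_inv_def compose_def)

lemma is_identity_at_piso_id:
  assumes "v \<in> verts E"
  shows "is_identity_at (PIso E) piso_cod piso_dom (piso_comp E) v (piso_id E v)"
  unfolding is_identity_at_def
proof (intro conjI ballI impI)
  show "piso_comp E g (piso_id E v) = g" if "g \<in> PIso E" "piso_dom g = v" for g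
    using piso_comp_id that by blast
  show "piso_comp E (piso_id E v) g = g" if "g \<in> PIso E" "piso_cod g = v" for g
    using piso_id_comp that by blast
qed (simp_all add: piso_id_in_PIso[OF assms], simp_all add: piso_id_def)

lemma PIso_dom_cod:
  "g \<in> PIso E \<Longrightarrow> piso_dom g \<in> verts E" "g \<in> PIso E \<Longrightarrow> piso_cod g \<in> verts E"
  by (simp_all add: PIso_def is_partial_iso_def)

lemma is_inverse_of_piso_inv:
  assumes "g \<in> PIso E"
  shows "is_inverse_of (PIso E) piso_cod piso_dom (piso_comp E) g (piso_inv E g)"
  \<comment> \<open>Both products become \<open>piso_id\<close>, so the two identity conditions are
    instances of \<open>is_identity_at_piso_id\<close>.\<close>
  unfolding is_inverse_of_def piso_comp_inv[OF assms] piso_inv_comp[OF assms]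
  by (intro conjI is_identity_at_piso_id PIso_dom_cod piso_inv_in_PIso assms)
    (simp_all add: piso_inv_def)

theorem proposition3p2:
  fixes E :: "('v, 'e) pre_digraph"
  assumes "wf_digraph E"
  shows "groupoid (PIso E) (verts E) piso_cod piso_dom (piso_comp E) \<and>
    (\<forall>v \<in> verts E. is_identity_at (PIso E) piso_cod piso_dom (piso_comp E) v (piso_id E v)) \<and>
    (\<forall>g \<in> PIso E. is_inverse_of (PIso E) piso_cod piso_dom (piso_comp E) g (piso_inv E g))"
proof (intro conjI ballI)
  show "groupoid (PIso E) (verts E) piso_cod piso_dom (piso_comp E)"
  proof
    show "\<exists>i. is_identity_at (PIso E) piso_cod piso_dom (piso_comp E) v i" if "v \<in> verts E" for v
      using is_identity_at_piso_id[OF that] by blast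
    show "\<exists>h. is_inverse_of (PIso E) piso_cod piso_dom (piso_comp E) g h" if "g \<in> PIso E" for g
      using is_inverse_of_piso_inv[OF that] by blast
  \<comment> \<open>Closure and associativity are applied while \<open>piso_comp\<close> is folded;
    unfolding it then settles the domain and codomain of a product.\<close>
  qed (simp_all add: PIso_dom_cod piso_comp_in_PIso piso_comp_assoc, simp_all add: piso_comp_def)
qed (simp_all add: is_identity_at_piso_id is_inverse_of_piso_inv)

end
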